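(* Consider the central-upwind finite volume scheme on triangular cells described in the context (central-upwind fluxes, piecewise linear reconstruction with positivity correction, well-balanced quadrature of the topography source term, semi-implicit discretization of the friction term), together with the forward Euler time discretization, for solving the two-dimensional shallow water equations with variable bottom topography $B$ and Manning bed friction. This scheme preserves the nontrivial steady-state solutions of the shallow water equations, namely the steady flows with non-vanishing velocity and constant water depth over an inclined topography of the form $$h=h_0\equiv\text{constant},\quad q_x=q_0\equiv\text{constant},\quad q_y\equiv0,\quad \partial_xB=-B_0\equiv\text{constant},\quad \partial_yB\equiv0,$$ or $$h=h_0\equiv\text{constant},\quad q_x\equiv0,\quad q_y=q_0\equiv\text{constant},\quad \partial_xB\equiv0,\quad \partial_yB=-B_0\equiv\text{constant},$$ where, by the momentum equations, $h_0=\left(\dfrac{n_f^2q_0^2}{B_0}\right)^{3/10}$.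
   Context: **Equations.** $g$ is the gravity acceleration, $n_f$ the Manning coefficient, $h$ the water depth, $B(x,y)$ the bottom topography, $w=h+B$ the free-surface elevation, $(u,v)$ the velocity, $q_x=hu$ and $q_y=hv$ the discharges, $U=(w,q_x,q_y)^T$. The shallow water system is $\partial_tU+\partial_xF(U,B)+\partial_yG(U,B)=S(U,B)+M$ with $$F=\Big(q_x,\ \tfrac{q_x^2}{w-B}+\tfrac g2(w-B)^2,\ \tfrac{q_xq_y}{w-B}\Big)^T,\quad G=\Big(q_y,\ \tfrac{q_xq_y}{w-B},\ \tfrac{q_y^2}{w-B}+\tfrac g2(w-B)^2\Big)^T,$$ $$S=\big(0,-g(w-B)\partial_xB,-g(w-B)\partial_yB\big)^T,\quad M=-\tfrac{gn_f^2}{h^{7/3}}\sqrt{q_x^2+q_y^2}\,(0,q_x,q_y)^T .$$ **Mesh.** The computational domain is partitioned into triangular cells $T_j$ of area $|T_j|$ and center of mass $(\bar x_j,\bar y_j)$. For $k=1,2,3$, $T_{jk}$ is the neighbor of $T_j$ across its $k$-th edge, which has length $d_{jk}$, midpoint $N_{jk}$ and unit normal $(\cos\theta_{jk},\sin\theta_{jk})$ pointing towards $T_{jk}$; $(\bar x_{jk},\bar y_{jk})$ is the center of mass of $T_{jk}$. **Topography.** $B$ is given at the cell vertices and reconstructed linearly on each cell (hence continuously). $B_{jk}$ is its value at $N_{jk}$ (average of the two edge end-point values) and $B_j$ is its average over $T_j$ (average of the three vertex values). **Unknowns.** Cell averages $\bar U_j=(\bar w_j,\bar q_{xj},\bar q_{yj})^T$,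 with $\bar h_j=\bar w_j-B_j$; a superscript $n$ denotes the value at time $t^n$, and $\Delta t$ is the time step. **Meaning of preservation.** If, at time $t^n$, the computed $\bar h_j^n,\bar q_{xj}^n,\bar q_{yj}^n$ equal the constant values of the steady state in the cells, then the same holds for $\bar h_j^{n+1},\bar q_{xj}^{n+1},\bar q_{yj}^{n+1}$ at time $t^{n+1}$. **Reconstruction.** On $T_j$, componentwise for $i=1,2,3$, $$U_j^{(i)}(x,y)=\bar U_j^{(i)}+(\partial U_j^{(i)})_x(x-\bar x_j)+(\partial U_j^{(i)})_y(y-\bar y_j).$$ The initial (unlimited) gradient $\partial\mathcal U_j^{(i)}$ of a cell $T_j$ is the gradient of the plane through the three points $(\bar x_{jk},\bar y_{jk},\bar U_{jk}^{(i)})$, $k=1,2,3$, where $\bar U_{jk}$ is the average over $T_{jk}$. With $\partial\mathcal U_{jk}^{(i)}$ the initial gradient of the neighbor $T_{jk}$, the gradient used is $\partial U_j^{(i)}=\sum_{k=1}^3\mathcal W_{jk}^{(i)}\,\partial\mathcal U_{jk}^{(i)}$, with $$\mathcal W_{jk}^{(i)}=\frac{\prod_{l\ne k}\|\partial\mathcal U_{jl}^{(i)}\|_2^2+\xi^2}{\sum_{l=1}^3\|\partial\mathcal U_{jl}^{(i)}\|_2^4+3\xi^2},\qquad \xi=10^{-7}.$$ $U_j(N_{jk})$ and $U_{jk}(N_{jk})$ are the values at $N_{jk}$ of the reconstructions from $T_j$ and $T_{jk}$, and $h_j(N_{jk})=w_j(N_{jk})-B_{jk}$, $h_{jk}(N_{jk})=w_{jk}(N_{jk})-B_{jk}$.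 $(\partial w_j)_x,(\partial w_j)_y$ are the gradient components for the first variable $w$. **Positivity correction.** If the linear function $w_j$ lies strictly below $B$ at some vertex of $T_j$, it is replaced by the linear function equal to $B$ at all such vertices and equal to $B+3\bar h_j/n^+$ at the remaining $n^+$ vertices. **Velocities and speeds.** Velocities at edge midpoints are $(u,v)=(q_x,q_y)/h$ if $h\ge\eta$ and $(u,v)=\frac{\sqrt2\,h}{\sqrt{h^4+\max\{h^4,\epsilon\}}}(q_x,q_y)$ if $h<\eta$, with $\eta=10^{-6}$, $\epsilon=\max_j|T_j|^2$. With $\lambda_j^\theta=\cos\theta_{jk}\,u_j(N_{jk})+\sin\theta_{jk}\,v_j(N_{jk})$ and $\lambda_{jk}^\theta=\cos\theta_{jk}\,u_{jk}(N_{jk})+\sin\theta_{jk}\,v_{jk}(N_{jk})$, $$b^{in}_{jk}=-\min\{\lambda_j^\theta-\sqrt{gh_j(N_{jk})},\ \lambda_{jk}^\theta-\sqrt{gh_{jk}(N_{jk})},\ 0\},$$ $$b^{out}_{jk}=\max\{\lambda_j^\theta+\sqrt{gh_j(N_{jk})},\ \lambda_{jk}^\theta+\sqrt{gh_{jk}(N_{jk})},\ 0\}.$$ **Scheme with forward Euler.** $$\begin{aligned}\bar U_j^{n+1}=\bar U_j^n&-\frac{\Delta t}{|T_j|}\sum_{k=1}^3\frac{d_{jk}\cos\theta_{jk}}{b^{in}_{jk}+b^{out}_{jk}}\big[b^{in}_{jk}F(U_{jk}(N_{jk}),B_{jk})+b^{out}_{jk}F(U_j(N_{jk}),B_{jk})\big]\\&-\frac{\Delta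 t}{|T_j|}\sum_{k=1}^3\frac{d_{jk}\sin\theta_{jk}}{b^{in}_{jk}+b^{out}_{jk}}\big[b^{in}_{jk}G(U_{jk}(N_{jk}),B_{jk})+b^{out}_{jk}G(U_j(N_{jk}),B_{jk})\big]\\&+\frac{\Delta t}{|T_j|}\sum_{k=1}^3\frac{d_{jk}b^{in}_{jk}b^{out}_{jk}}{b^{in}_{jk}+b^{out}_{jk}}\big[U_{jk}(N_{jk})-U_j(N_{jk})\big]+\Delta t\,\bar S_j+\Delta t\,\bar M_j,\end{aligned}$$ where reconstructed quantities, speeds and $\bar S_j$ are evaluated at time $t^n$, $\bar S_j^{(1)}=0$, $$\bar S_j^{(2)}=\frac{g}{2|T_j|}\sum_{k=1}^3d_{jk}[B_{jk}-w_j(N_{jk})]^2\cos\theta_{jk}+g(\partial w_j)_x[B_j-\bar w_j],$$ $$\bar S_j^{(3)}=\frac{g}{2|T_j|}\sum_{k=1}^3d_{jk}[B_{jk}-w_j(N_{jk})]^2\sin\theta_{jk}+g(\partial w_j)_y[B_j-\bar w_j],$$ and the friction term is semi-implicit: $$\bar M_j=-\frac{gn_f^2}{2}\,\frac{\sqrt{(\bar q_{xj}^n)^2+(\bar q_{yj}^n)^2}}{(\bar h_j^n)^{7/3}}\,\big(0,\ \bar q_{xj}^n+\bar q_{xj}^{n+1},\ \bar q_{yj}^n+\bar q_{yj}^{n+1}\big)^T .$$ *)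

theory Defs
  imports "HOL-Analysis.Analysis"
begin

text \<open>
  A cell is given by its three vertices, indexed by the cyclic type \<open>3\<close>.  Edge \<open>k\<close> is the one opposite
  vertex \<open>k\<close>, with end points \<open>T $ (k + 1)\<close> and \<open>T $ (k + 2)\<close> (addition modulo 3).
  A state is \<open>(w, q\<^sub>x, q\<^sub>y)\<close>; a cell function \<open>cell \<Rightarrow> state\<close> holds the cell averages.
\<close>

type_synonym cell = "real^2^3"
type_synonym state = "real^3"

subsection \<open>Shallow water equations\<close>

definition flux_x :: "real \<Rightarrow> state \<Rightarrow> real \<Rightarrow> state" where
  "flux_x g U b = vector [U$2, (U$2)\<^sup>2 / (U$1 - b) + g / 2 * (U$1 - b)\<^sup>2, U$2 * U$3 / (U$1 - b)]"

definition flux_y :: "real \<Rightarrow> state \<Rightarrow> real \<Rightarrow> state" where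
  "flux_y g U b = vector [U$3, U$2 * U$3 / (U$1 - b), (U$3)\<^sup>2 / (U$1 - b) + g / 2 * (U$1 - b)\<^sup>2]"

definition bed_source :: "real \<Rightarrow> state \<Rightarrow> real \<Rightarrow> real \<Rightarrow> real \<Rightarrow> state" where
  "bed_source g U b bx by' = vector [0, - g * (U$1 - b) * bx, - g * (U$1 - b) * by']"

definition friction_source :: "real \<Rightarrow> real \<Rightarrow> state \<Rightarrow> real \<Rightarrow> state" where
  "friction_source g nf U b =
     (- (g * nf\<^sup>2 / (U$1 - b) powr (7/3)) * sqrt ((U$2)\<^sup>2 + (U$3)\<^sup>2)) *\<^sub>R vector [0, U$2, U$3]"

definition has_partial :: "(real^2 \<Rightarrow> 'a::real_normed_vector) \<Rightarrow> 2 \<Rightarrow> 'a \<Rightarrow> real^2 \<Rightarrow> bool" where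
  "has_partial f i D p \<longleftrightarrow> ((\<lambda>s. f (p + s *\<^sub>R axis i 1)) has_vector_derivative D) (at 0)"

text \<open>Time-independent solutions on \<open>\<Omega>\<close>: the balance law with \<open>\<partial>\<^sub>t U = 0\<close>.\<close>

definition swe_steady_state ::
    "real \<Rightarrow> real \<Rightarrow> (real^2) set \<Rightarrow> (real^2 \<Rightarrow> real) \<Rightarrow> (real^2 \<Rightarrow> state) \<Rightarrow> bool" where
  "swe_steady_state g nf \<Omega> B U \<longleftrightarrow>
     (\<forall>p\<in>\<Omega>. \<exists>Fx Gy Bx By.
        has_partial (\<lambda>x. flux_x g (U x) (B x)) 1 Fx p \<and>
        has_partial (\<lambda>x. flux_y g (U x) (B x)) 2 Gy p \<and>
        has_partial B 1 Bx p \<and> has_partial B 2 By p \<and>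
        Fx + Gy = bed_source g (U p) (B p) Bx By + friction_source g nf (U p) (B p))"

subsection \<open>Mesh\<close>

definition verts :: "cell \<Rightarrow> (real^2) set" where
  "verts T = range (($) T)"

definition region :: "cell \<Rightarrow> (real^2) set" where
  "region T = convex hull (verts T)"

text \<open>Finite conforming triangulations of a planar region; \<open>inj_on verts M\<close> excludes listing one triangle twice with its vertices
  in different orders.\<close>

definition conforming_mesh :: "cell set \<Rightarrow> bool" where
  "conforming_mesh M \<longleftrightarrow>
     finite M \<and> M \<noteq> {} \<and> inj_on verts M \<and>
     (\<forall>T\<in>M. \<not> collinear (verts T)) \<and>
     (\<forall>T\<in>M. \<forall>T'\<in>M. region T \<inter> region T' = convex hull (verts T \<inter> verts T'))"

definition domain :: "cell set \<Rightarrow> (real^2) set" where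
  "domain M = (\<Union>T\<in>M. region T)"

definition area :: "cell \<Rightarrow> real" where
  "area T = measure lebesgue (region T)"

definition center :: "cell \<Rightarrow> real^2" where
  "center T = (1/3) *\<^sub>R (\<Sum>k\<in>UNIV. T $ k)"

definition edge_length :: "cell \<Rightarrow> 3 \<Rightarrow> real" where
  "edge_length T k = dist (T $ (k + 1)) (T $ (k + 2))"

definition edge_mid :: "cell \<Rightarrow> 3 \<Rightarrow> real^2" where
  "edge_mid T k = midpoint (T $ (k + 1)) (T $ (k + 2))"

text \<open>The outer unit normal \<open>(cos \<theta>, sin \<theta>)\<close>: the edge vector rotated by a right angle and normalised,
  with the sign chosen so that it points away from the opposite vertex \<open>k\<close>.\<close>

definition normal :: "cell \<Rightarrow> 3 \<Rightarrow> real^2" where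
  "normal T k =
     (let e = T $ (k + 2) - T $ (k + 1); r = vector [e $ 2, - (e $ 1)]
      in ((if r \<bullet> (T $ k - T $ (k + 1)) < 0 then 1 else -1) / norm e) *\<^sub>R r)"

definition is_nbr :: "cell set \<Rightarrow> cell \<Rightarrow> 3 \<Rightarrow> cell \<Rightarrow> bool" where
  "is_nbr M T k T' \<longleftrightarrow> T' \<in> M \<and> T' \<noteq> T \<and> {T $ (k + 1), T $ (k + 2)} \<subseteq> verts T'"

text \<open>In a conforming mesh at most one cell satisfies the condition; the value is meaningful only if
  edge \<open>k\<close> is not on the boundary of the mesh.\<close>

definition nbr :: "cell set \<Rightarrow> cell \<Rightarrow> 3 \<Rightarrow> cell" where
  "nbr M T k = (SOME T'. is_nbr M T k T')"

text \<open>\<open>inner_cells M m\<close> are the cells surrounded by at least \<open>m\<close> layers of neighbors.\<close>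

primrec inner_cells :: "cell set \<Rightarrow> nat \<Rightarrow> cell set" where
  "inner_cells M 0 = M"
| "inner_cells M (Suc m) =
     {T \<in> M. \<forall>k. (\<exists>T'. is_nbr M T k T') \<and> nbr M T k \<in> inner_cells M m}"

text \<open>The cells on which the scheme is defined.  Initial gradients use one layer of neighbors, weighted
  gradients two, and the fluxes use the weighted gradients of the neighbors, hence three layers.\<close>

definition evolved_cells :: "cell set \<Rightarrow> cell set" where
  "evolved_cells M = inner_cells M 3"

text \<open>The requirement under which ``the plane through the three points'' over the neighboring centers
  of mass, which defines the initial gradient, exists and is unique.\<close>

definition planes_determined :: "cell set \<Rightarrow> bool" where
  "planes_determined M \<longleftrightarrow>
     (\<forall>T\<in>inner_cells M 1. \<not> collinear (range (\<lambda>k. center (nbr M T k))))"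

subsection \<open>Topography values\<close>

text \<open>Only the vertex values of \<open>B\<close> enter the scheme, through its linear interpolant on each cell.\<close>

definition B_mid :: "(real^2 \<Rightarrow> real) \<Rightarrow> cell \<Rightarrow> 3 \<Rightarrow> real" where
  "B_mid B T k = (B (T $ (k + 1)) + B (T $ (k + 2))) / 2"

definition B_avg :: "(real^2 \<Rightarrow> real) \<Rightarrow> cell \<Rightarrow> real" where
  "B_avg B T = (\<Sum>k\<in>UNIV. B (T $ k)) / 3"

subsection \<open>Reconstruction\<close>

definition plane_gradient :: "(3 \<Rightarrow> real^2) \<Rightarrow> (3 \<Rightarrow> real) \<Rightarrow> real^2" where
  "plane_gradient p a = (THE G. \<exists>c. \<forall>k. a k = G \<bullet> p k + c)"

definition init_grad :: "cell set \<Rightarrow> (cell \<Rightarrow> state) \<Rightarrow> 3 \<Rightarrow> cell \<Rightarrow> real^2" where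
  "init_grad M U i T = plane_gradient (\<lambda>k. center (nbr M T k)) (\<lambda>k. U (nbr M T k) $ i)"

definition weight :: "cell set \<Rightarrow> (cell \<Rightarrow> state) \<Rightarrow> 3 \<Rightarrow> cell \<Rightarrow> 3 \<Rightarrow> real" where
  "weight M U i T k =
     (let \<xi> = 1 / 10 ^ 7; N = (\<lambda>l. norm (init_grad M U i (nbr M T l)))
      in ((\<Prod>l\<in>UNIV - {k}. N l ^ 2) + \<xi>\<^sup>2) / ((\<Sum>l\<in>UNIV. N l ^ 4) + 3 * \<xi>\<^sup>2))"

definition grad :: "cell set \<Rightarrow> (cell \<Rightarrow> state) \<Rightarrow> 3 \<Rightarrow> cell \<Rightarrow> real^2" where
  "grad M U i T = (\<Sum>k\<in>UNIV. weight M U i T k *\<^sub>R init_grad M U i (nbr M T k))"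

definition lin_rec :: "cell set \<Rightarrow> (cell \<Rightarrow> state) \<Rightarrow> 3 \<Rightarrow> cell \<Rightarrow> real^2 \<Rightarrow> real" where
  "lin_rec M U i T p = U T $ i + grad M U i T \<bullet> (p - center T)"

text \<open>Positivity correction of the first component.\<close>

definition dry :: "cell set \<Rightarrow> (real^2 \<Rightarrow> real) \<Rightarrow> (cell \<Rightarrow> state) \<Rightarrow> cell \<Rightarrow> 3 set" where
  "dry M B U T = {k. lin_rec M U 1 T (T $ k) < B (T $ k)}"

definition corrected_vertex_val ::
    "cell set \<Rightarrow> (real^2 \<Rightarrow> real) \<Rightarrow> (cell \<Rightarrow> state) \<Rightarrow> cell \<Rightarrow> 3 \<Rightarrow> real" where
  "corrected_vertex_val M B U T k =
     (if k \<in> dry M B U T then B (T $ k)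
      else B (T $ k) + 3 * (U T $ 1 - B_avg B T) / real (card (- dry M B U T)))"

text \<open>The gradient of the reconstruction of \<open>w\<close> after the positivity correction.\<close>

definition w_grad :: "cell set \<Rightarrow> (real^2 \<Rightarrow> real) \<Rightarrow> (cell \<Rightarrow> state) \<Rightarrow> cell \<Rightarrow> real^2" where
  "w_grad M B U T =
     (if dry M B U T = {} then grad M U 1 T
      else plane_gradient (($) T) (corrected_vertex_val M B U T))"

definition w_rec ::
    "cell set \<Rightarrow> (real^2 \<Rightarrow> real) \<Rightarrow> (cell \<Rightarrow> state) \<Rightarrow> cell \<Rightarrow> real^2 \<Rightarrow> real" where
  "w_rec M B U T p =
     (if dry M B U T = {} then lin_rec M U 1 T p
      else corrected_vertex_val M B U T 1 + w_grad M B U T \<bullet> (p - T $ 1))"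

definition reconstruction ::
    "cell set \<Rightarrow> (real^2 \<Rightarrow> real) \<Rightarrow> (cell \<Rightarrow> state) \<Rightarrow> cell \<Rightarrow> real^2 \<Rightarrow> state" where
  "reconstruction M B U T p = vector [w_rec M B U T p, lin_rec M U 2 T p, lin_rec M U 3 T p]"

subsection \<open>Velocities and one-sided speeds\<close>

definition eps :: "cell set \<Rightarrow> real" where
  "eps M = Max ((\<lambda>T. (area T)\<^sup>2) ` M)"

definition velocity :: "cell set \<Rightarrow> real \<Rightarrow> state \<Rightarrow> real^2" where
  "velocity M h U =
     (if h \<ge> 1 / 10 ^ 6 then 1 / h else sqrt 2 * h / sqrt (h ^ 4 + max (h ^ 4) (eps M)))
       *\<^sub>R vector [U$2, U$3]"

definition U_in :: "cell set \<Rightarrow> (real^2 \<Rightarrow> real) \<Rightarrow> (cell \<Rightarrow> state) \<Rightarrow> cell \<Rightarrow> 3 \<Rightarrow> state" where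
  "U_in M B U T k = reconstruction M B U T (edge_mid T k)"

definition U_out :: "cell set \<Rightarrow> (real^2 \<Rightarrow> real) \<Rightarrow> (cell \<Rightarrow> state) \<Rightarrow> cell \<Rightarrow> 3 \<Rightarrow> state" where
  "U_out M B U T k = reconstruction M B U (nbr M T k) (edge_mid T k)"

definition b_in ::
    "real \<Rightarrow> cell set \<Rightarrow> (real^2 \<Rightarrow> real) \<Rightarrow> (cell \<Rightarrow> state) \<Rightarrow> cell \<Rightarrow> 3 \<Rightarrow> real" where
  "b_in g M B U T k =
     (let hi = U_in M B U T k $ 1 - B_mid B T k; ho = U_out M B U T k $ 1 - B_mid B T k;
          li = normal T k \<bullet> velocity M hi (U_in M B U T k);
          lo = normal T k \<bullet> velocity M ho (U_out M B U T k)
      in - min (li - sqrt (g * hi)) (min (lo - sqrt (g * ho)) 0))"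

definition b_out ::
    "real \<Rightarrow> cell set \<Rightarrow> (real^2 \<Rightarrow> real) \<Rightarrow> (cell \<Rightarrow> state) \<Rightarrow> cell \<Rightarrow> 3 \<Rightarrow> real" where
  "b_out g M B U T k =
     (let hi = U_in M B U T k $ 1 - B_mid B T k; ho = U_out M B U T k $ 1 - B_mid B T k;
          li = normal T k \<bullet> velocity M hi (U_in M B U T k);
          lo = normal T k \<bullet> velocity M ho (U_out M B U T k)
      in max (li + sqrt (g * hi)) (max (lo + sqrt (g * ho)) 0))"

subsection \<open>The scheme\<close>

text \<open>The averaged source; \<open>i = 1, 2\<close> are the \<open>x\<close> and \<open>y\<close> components.\<close>

definition source_comp ::
    "real \<Rightarrow> cell set \<Rightarrow> (real^2 \<Rightarrow> real) \<Rightarrow> (cell \<Rightarrow> state) \<Rightarrow> cell \<Rightarrow> 2 \<Rightarrow> real" where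
  "source_comp g M B U T i =
     g / (2 * area T) *
       (\<Sum>k\<in>UNIV. edge_length T k * (B_mid B T k - U_in M B U T k $ 1)\<^sup>2 * normal T k $ i)
     + g * w_grad M B U T $ i * (B_avg B T - U T $ 1)"

definition source ::
    "real \<Rightarrow> cell set \<Rightarrow> (real^2 \<Rightarrow> real) \<Rightarrow> (cell \<Rightarrow> state) \<Rightarrow> cell \<Rightarrow> state" where
  "source g M B U T = vector [0, source_comp g M B U T 1, source_comp g M B U T 2]"

text \<open>The semi-implicit friction: \<open>V\<close> is the average over \<open>T\<close> at the new time level.\<close>

definition friction ::
    "real \<Rightarrow> real \<Rightarrow> (real^2 \<Rightarrow> real) \<Rightarrow> (cell \<Rightarrow> state) \<Rightarrow> cell \<Rightarrow> state \<Rightarrow> state" where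
  "friction g nf B U T V =
     (- (g * nf\<^sup>2 / 2) * (sqrt ((U T $ 2)\<^sup>2 + (U T $ 3)\<^sup>2) / (U T $ 1 - B_avg B T) powr (7/3)))
       *\<^sub>R vector [0, U T $ 2 + V $ 2, U T $ 3 + V $ 3]"

text \<open>\<open>euler_step g nf dt M B U T V\<close>: from the averages \<open>U\<close> at the old time level, the scheme
  yields the average \<open>V\<close> over \<open>T\<close> at the new one.  It is a relation since \<open>V\<close> occurs on both sides.\<close>

definition euler_step ::
    "real \<Rightarrow> real \<Rightarrow> real \<Rightarrow> cell set \<Rightarrow> (real^2 \<Rightarrow> real) \<Rightarrow> (cell \<Rightarrow> state) \<Rightarrow> cell \<Rightarrow> state \<Rightarrow> bool" where
  "euler_step g nf dt M B U T V \<longleftrightarrow>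
     (let d = edge_length T; \<nu> = normal T; Ui = U_in M B U T; Uo = U_out M B U T;
          Bm = B_mid B T; bi = b_in g M B U T; bo = b_out g M B U T
      in V = U T
         - (dt / area T) *\<^sub>R (\<Sum>k\<in>UNIV. (d k * \<nu> k $ 1 / (bi k + bo k)) *\<^sub>R
              (bi k *\<^sub>R flux_x g (Uo k) (Bm k) + bo k *\<^sub>R flux_x g (Ui k) (Bm k)))
         - (dt / area T) *\<^sub>R (\<Sum>k\<in>UNIV. (d k * \<nu> k $ 2 / (bi k + bo k)) *\<^sub>R
              (bi k *\<^sub>R flux_y g (Uo k) (Bm k) + bo k *\<^sub>R flux_y g (Ui k) (Bm k)))
         + (dt / area T) *\<^sub>R (\<Sum>k\<in>UNIV. (d k * bi k * bo k / (bi k + bo k)) *\<^sub>R (Uo k - Ui k))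
         + dt *\<^sub>R source g M B U T + dt *\<^sub>R friction g nf B U T V)"

definition has_cell_values :: "(real^2 \<Rightarrow> real) \<Rightarrow> real \<Rightarrow> real^2 \<Rightarrow> cell \<Rightarrow> state \<Rightarrow> bool" where
  "has_cell_values B h q T V \<longleftrightarrow> V $ 1 - B_avg B T = h \<and> V $ 2 = q $ 1 \<and> V $ 3 = q $ 2"

text \<open>The existence clause makes sure that the implicit step can be carried out.\<close>

definition preserves ::
    "real \<Rightarrow> real \<Rightarrow> real \<Rightarrow> cell set \<Rightarrow> (real^2 \<Rightarrow> real) \<Rightarrow> real \<Rightarrow> real^2 \<Rightarrow> bool" where
  "preserves g nf dt M B h q \<longleftrightarrow>
     (\<forall>U. (\<forall>T\<in>M. has_cell_values B h q T (U T)) \<longrightarrow>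
        (\<forall>T\<in>evolved_cells M.
           (\<exists>V. euler_step g nf dt M B U T V) \<and>
           (\<forall>V. euler_step g nf dt M B U T V \<longrightarrow> has_cell_values B h q T V)))"

end

theory Submission
  imports Defs
begin

text \<open>
  On each cell \<open>B\<close> is affine with gradient \<open>b\<close>, and neighboring cells, sharing two vertices, share the
  additive constant.  Hence the averages of \<open>w\<close> lie on the plane \<open>h\<^sub>0 + B\<close>, which the weighted gradients
  reproduce exactly since equal initial gradients have weights \<open>1/3\<close>; no vertex is dry.  The
  reconstructions from both sides of an edge agree there with depth \<open>h\<^sub>0\<close>, so the numerical flux is the
  same physical flux on every edge, and its sum vanishes because \<open>\<Sum>\<^sub>k d\<^sub>k \<nu>\<^sub>k = 0\<close>.  What remains is
  \<open>V = U - \<Delta>t g h\<^sub>0 b - \<Delta>t \<kappa> (q + V)\<close> for the discharges, where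
  \<open>\<kappa> = g n\<^sub>f\<^sup>2 |q| / (2 h\<^sub>0\<^sup>7\<^sup>/\<^sup>3)\<close>, and the momentum balance of the steady state says \<open>g h\<^sub>0 b = - 2 \<kappa> q\<close>; thus \<open>V = U\<close> is the unique solution.
\<close>

section \<open>From partial derivatives to affine topography on each cell\<close>

text \<open>Convexity of \<open>S\<close> makes the admissible parameters of the line an interval,
  on which a vanishing derivative forces constancy.\<close>

lemma has_partial_zero_imp_constant_on_line:
  fixes f :: "real^2 \<Rightarrow> real"
  assumes "convex S" and "\<forall>p\<in>S. has_partial f i 0 p" and "p \<in> S" and "p + s *\<^sub>R axis i 1 \<in> S"
  shows "f (p + s *\<^sub>R axis i 1) = f p"
proof -
  define A where "A = {t. p + t *\<^sub>R axis i 1 \<in> S}"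
  have cA: "convex A"
    unfolding convex_def
  proof (intro ballI allI impI)
    fix s t u v :: real
    assume *: "s \<in> A" "t \<in> A" "0 \<le> u" "0 \<le> v" "u + v = 1"
    have "u *\<^sub>R p + v *\<^sub>R p = p" using *(5) by (simp flip: scaleR_add_left)
    hence "p + (u *\<^sub>R s + v *\<^sub>R t) *\<^sub>R axis i 1 = u *\<^sub>R (p + s *\<^sub>R axis i 1) + v *\<^sub>R (p + t *\<^sub>R axis i 1)"
      by (simp add: scaleR_add_left scaleR_add_right)
    thus "u *\<^sub>R s + v *\<^sub>R t \<in> A"
      using * assms(1) by (simp add: A_def convex_def)
  qed
  have "((\<lambda>t. f (p + t *\<^sub>R axis i 1)) has_vector_derivative 0) (at t within A)" if "t \<in> A" for t
  proof -
    \<comment> \<open>\<open>has_partial\<close> always differentiates at parameter 0; the base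
      point is moved to parameter \<open>t\<close> of the fixed line.\<close>
    have "((\<lambda>s. f (p + t *\<^sub>R axis i 1 + s *\<^sub>R axis i 1)) has_vector_derivative 0) (at 0)"
      using assms(2) that by (auto simp: A_def has_partial_def)
    hence "((\<lambda>s. f (p + (s + t) *\<^sub>R axis i 1)) has_field_derivative 0) (at 0)"
      by (simp add: has_real_derivative_iff_has_vector_derivative algebra_simps)
    hence "((\<lambda>s. f (p + s *\<^sub>R axis i 1)) has_field_derivative 0) (at (0 + t))"
      by (subst DERIV_shift)
    thus ?thesis
      by (simp add: has_real_derivative_iff_has_vector_derivative has_vector_derivative_at_within)
  qed
  from has_vector_derivative_zero_constant[OF cA this]
  obtain c where "\<And>t. t \<in> A \<Longrightarrow> f (p + t *\<^sub>R axis i 1) = c" by blast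
  from this[of 0] this[of s] show ?thesis using assms(3,4) by (simp add: A_def)
qed

text \<open>Partial derivatives alone do not give differentiability. Inside a ball, however, two
  axis-parallel moves join the center to any point, so \<open>f\<close> is locally constant and its
  total derivative is zero.\<close>

lemma has_partial_zero_imp_constant:
  fixes f :: "real^2 \<Rightarrow> real"
  assumes "convex S" and "open S" and zero: "\<And>i. \<forall>p\<in>S. has_partial f i 0 p"
  shows "\<exists>c. \<forall>p\<in>S. f p = c"
proof -
  have "(f has_derivative (\<lambda>_. 0)) (at x within S)" if "x \<in> S" for x
  proof -
    obtain e where e: "e > 0" "ball x e \<subseteq> S" using openE[OF \<open>open S\<close> \<open>x \<in> S\<close>] .
    have const: "f x = f y" if y: "y \<in> ball x e" for y
    proof -
      \<comment> \<open>The corner of the path; it stays in the ball since \<open>z - x\<close> is a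
        coordinate projection of \<open>y - x\<close>.\<close>
      define z where "z = x + (y$1 - x$1) *\<^sub>R axis 1 1"
      have yz: "y = z + (y$2 - x$2) *\<^sub>R axis 2 1"
        by (simp add: z_def vec_eq_iff forall_2 axis_def)
      have "norm (z - x) \<le> norm (y - x)"
        using component_le_norm_cart[of "y - x" 1] by (simp add: z_def)
      hence z: "z \<in> ball x e" using y by (simp add: dist_norm norm_minus_commute)
      have zero': "\<forall>p\<in>ball x e. has_partial f i 0 p" for i using zero[of i] e(2) by auto
      have "f z = f x"
        using has_partial_zero_imp_constant_on_line[OF convex_ball zero', of x "y$1 - x$1" 1] z e(1)
        by (simp add: z_def)
      moreover have "f y = f z"
        using has_partial_zero_imp_constant_on_line[OF convex_ball zero', of z "y$2 - x$2" 2] z y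
        by (simp flip: yz)
      ultimately show ?thesis by simp
    qed
    have "(f has_derivative (\<lambda>_. 0)) (at x)"
      using e(1)
      by (intro has_derivative_transform_within_open[OF has_derivative_const open_ball _ const])
        (simp_all only: centre_in_ball)
    thus ?thesis by (rule has_derivative_at_withinI)
  qed
  from has_derivative_zero_constant[OF assms(1) this] show ?thesis by blast
qed

lemma has_partial_imp_affine:
  fixes f :: "real^2 \<Rightarrow> real"
  assumes "convex S" and "open S" and "\<forall>p\<in>S. has_partial f 1 (b $ 1) p \<and> has_partial f 2 (b $ 2) p"
  shows "\<exists>c. \<forall>p\<in>S. f p = b \<bullet> p + c"
proof -
  have D: "has_partial f i (b $ i) p" if "p \<in> S" for i p
    using assms(3) that exhaust_2[of i] by auto
  have "has_partial (\<lambda>x. f x - b \<bullet> x) i 0 p" if "p \<in> S" for i p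
  proof -
    have "((\<lambda>s. f (p + s *\<^sub>R axis i 1) - b \<bullet> (p + s *\<^sub>R axis i 1)) has_vector_derivative
            b $ i - b \<bullet> axis i 1) (at 0)"
      using D[OF that, of i] unfolding has_partial_def inner_add_right inner_scaleR_right
      by (auto intro!: derivative_eq_intros simp flip: has_real_derivative_iff_has_vector_derivative)
    thus ?thesis by (simp add: has_partial_def inner_axis)
  qed
  from has_partial_zero_imp_constant[OF assms(1,2), of "\<lambda>x. f x - b \<bullet> x"] this
  obtain c where "\<forall>p\<in>S. f p - b \<bullet> p = c" by blast
  thus ?thesis by (intro exI[of _ c]) (auto simp: algebra_simps)
qed

lemma verts_eq: "verts T = {T$1, T$2, T$3}"
  by (auto simp: verts_def UNIV_3)

text \<open>Three affinely independent points in the plane span a convex set with interior. This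
  lets identities known only in the interior reach the vertices.\<close>

lemma region_eq_closure_interior:
  assumes "\<not> collinear (verts T)"
  shows "interior (region T) \<noteq> {}" and "region T = closure (interior (region T))"
proof -
  have ne: "T$1 \<noteq> T$2" "T$1 \<noteq> T$3" "T$2 \<noteq> T$3"
    using assms by (auto simp: verts_eq insert_commute)
  hence "\<not> affine_dependent (verts T)" using assms
    by (auto simp: verts_eq collinear_3_eq_affine_dependent)
  moreover have "card (verts T) = Suc (DIM(real^2))" using ne by (simp add: verts_eq)
  ultimately show 1: "interior (region T) \<noteq> {}"
    unfolding region_def by (metis interior_convex_hull_eq_empty)
  have "closed (region T)"
    unfolding region_def by (simp add: verts_eq compact_imp_closed finite_imp_compact compact_convex_hull)
  thus "region T = closure (interior (region T))"
    using convex_closure_interior[of "region T"] 1 by (simp add: region_def)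
qed

text \<open>Partial derivatives are prescribed only inside the domain; continuity extends the affine
  form to the vertices, whose values are all that the scheme uses.\<close>

lemma affine_on_cell:
  assumes "conforming_mesh M" and "continuous_on (domain M) B"
    and part: "\<forall>p\<in>interior (domain M). has_partial B 1 (b $ 1) p \<and> has_partial B 2 (b $ 2) p"
    and T: "T \<in> M"
  shows "\<exists>c. \<forall>k. B (T $ k) = b \<bullet> T $ k + c"
proof -
  let ?I = "interior (region T)"
  have sub: "region T \<subseteq> domain M" using T by (auto simp: domain_def)
  have "\<not> collinear (verts T)" using assms by (auto simp: conforming_mesh_def)
  note R = region_eq_closure_interior[OF this]
  have "\<forall>p\<in>?I. has_partial B 1 (b $ 1) p \<and> has_partial B 2 (b $ 2) p"
    using part interior_mono[OF sub] by blast
  with has_partial_imp_affine[of ?I B b]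
  obtain c where c: "\<forall>p\<in>?I. B p = b \<bullet> p + c"
    by (auto simp: region_def convex_interior)
  have "continuous_on (closure ?I) (\<lambda>p. B p - b \<bullet> p)"
    using continuous_on_subset[OF assms(2) sub] R(2) by (auto intro!: continuous_intros)
  hence "B p - b \<bullet> p = c" if "p \<in> region T" for p
    using continuous_constant_on_closure[of ?I "\<lambda>p. B p - b \<bullet> p" c p] c R(2) that by auto
  moreover have "T $ k \<in> region T" for k
    unfolding region_def by (rule hull_inc) (auto simp: verts_def)
  ultimately show ?thesis by (intro exI[of _ c]) (auto simp: algebra_simps)
qed

section \<open>Exact reconstruction of affine data\<close>

lemma three_arith: "(4::3) = 1" "(5::3) = 2"
  by simp_all

lemma nbr_is_nbr:
  assumes "T \<in> inner_cells M (Suc m)"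
  shows "is_nbr M T k (nbr M T k)"
  using assms by (auto simp: nbr_def intro: someI_ex)

lemma inner_cells_Suc_subset: "inner_cells M (Suc m) \<subseteq> inner_cells M m"
proof (induction m)
  case (Suc m)
  thus ?case by (subst inner_cells.simps, subst (2) inner_cells.simps) blast
qed auto

text \<open>The difference \<open>D\<close> of two candidate gradients is orthogonal to all
  differences of the points; if nonzero, it would confine them to a line.\<close>

lemma plane_gradient_eqI:
  assumes "\<not> collinear (range p)" and "\<And>k. a k = G \<bullet> p k + c"
  shows "plane_gradient p a = G"
  unfolding plane_gradient_def
proof (rule the_equality)
  show "\<exists>c. \<forall>k. a k = G \<bullet> p k + c" using assms(2) by blast
next
  fix G' assume "\<exists>c. \<forall>k. a k = G' \<bullet> p k + c"
  then obtain c' where c': "\<And>k. a k = G' \<bullet> p k + c'" by blast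
  define D where "D = G' - G"
  have D: "D \<bullet> (p k - p l) = 0" for k l
    using c'[of k] c'[of l] assms(2)[of k] assms(2)[of l] by (simp add: D_def algebra_simps)
  show "G' = G"
  proof (rule ccontr)
    assume "G' \<noteq> G"
    hence nz: "(D$1)\<^sup>2 + (D$2)\<^sup>2 \<noteq> 0" by (auto simp: D_def vec_eq_iff forall_2 sum_power2_eq_zero_iff)
    have "\<exists>t. z = t *\<^sub>R vector [- D$2, D$1]" if "D \<bullet> z = 0" for z :: "real^2"
    proof (intro exI)
      have z: "D$1 * z$1 + D$2 * z$2 = 0" using that by (simp add: inner_vec_def sum_2)
      \<comment> \<open>The coefficient of the orthogonal projection of \<open>z\<close> onto
        \<open>D\<close> rotated by a right angle.\<close>
      show "z = ((z$2 * D$1 - z$1 * D$2) / ((D$1)\<^sup>2 + (D$2)\<^sup>2)) *\<^sub>R vector [- D$2, D$1]"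
        using nz z unfolding vec_eq_iff forall_2
        by (simp add: divide_simps) algebra
    qed
    hence "collinear (range p)" using D unfolding collinear_def by blast
    thus False using assms(1) by blast
  qed
qed

context
  fixes M :: "cell set" and U :: "cell \<Rightarrow> state" and i :: 3 and G :: "real^2" and a :: "cell \<Rightarrow> real"
  assumes planes: "planes_determined M"
    and avg: "\<And>T. T \<in> M \<Longrightarrow> U T $ i = G \<bullet> center T + a T"
    and nbr_const: "\<And>T k T'. T \<in> M \<Longrightarrow> is_nbr M T k T' \<Longrightarrow> a T' = a T"
begin

text \<open>The offset \<open>a\<close> may vary over the mesh, but the three neighbors share that
  of \<open>T\<close>, so their points lie on one plane. Applied with slope \<open>b\<close> for the
  surface and slope 0 for the discharges.\<close>

lemma init_grad_affine:
  assumes "T \<in> inner_cells M 1"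
  shows "init_grad M U i T = G"
  unfolding init_grad_def
proof (rule plane_gradient_eqI)
  show "\<not> collinear (range (\<lambda>k. center (nbr M T k)))"
    using planes assms by (auto simp: planes_determined_def)
  fix k
  have "T \<in> M" using assms by simp
  moreover have "is_nbr M T k (nbr M T k)" using assms nbr_is_nbr[of T M 0] by simp
  ultimately show "U (nbr M T k) $ i = G \<bullet> center (nbr M T k) + a T"
    using avg[of "nbr M T k"] nbr_const by (auto simp: is_nbr_def)
qed

lemma grad_affine:
  assumes "T \<in> inner_cells M 2"
  shows "grad M U i T = G"
proof -
  have ig: "init_grad M U i (nbr M T k) = G" for k
    using assms by (intro init_grad_affine) (simp add: numeral_2_eq_2)
  have w: "weight M U i T k = 1/3" for k
  proof -
    have "card (UNIV - {k}) = 2" by simp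
    \<comment> \<open>The regularization keeps the denominator of the weights positive even for
      \<open>G = 0\<close>, the case of the discharges.\<close>
    moreover have "norm G ^ 4 + (1 / 10 ^ 7)\<^sup>2 > 0" by (intro add_nonneg_pos) auto
    ultimately show ?thesis
      by (simp add: weight_def ig Let_def power_mult[symmetric] field_simps)
  qed
  show ?thesis by (simp add: grad_def ig w sum_3 flip: scaleR_add_left)
qed

lemma lin_rec_affine:
  assumes "T \<in> inner_cells M 2"
  shows "lin_rec M U i T p = G \<bullet> p + a T"
proof -
  have "T \<in> M" using assms by (simp add: numeral_2_eq_2)
  thus ?thesis using avg[of T] by (simp add: lin_rec_def grad_affine[OF assms] inner_diff_right)
qed

end

section \<open>Edge normals\<close>

text \<open>Either side is minus twice the signed area of the triangle, so \<open>normal\<close>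
  chooses the same sign on all three edges.\<close>

lemma rotated_edge_inner:
  fixes T :: cell
  shows "vector [(T$(k+2) - T$(k+1))$2, - ((T$(k+2) - T$(k+1))$1)] \<bullet> (T$k - T$(k+1))
     = vector [(T$3 - T$2)$2, - ((T$3 - T$2)$1)] \<bullet> (T$1 - T$2)"
  using exhaust_3[of k] by (auto simp: inner_vec_def sum_2 three_arith algebra_simps)

text \<open>Up to the common sign \<open>s\<close>, length times normal is the rotated edge vector,
  and the edge vectors of a closed triangle add up to zero.\<close>

lemma sum_edge_length_normal:
  assumes "\<not> collinear (verts T)"
  shows "(\<Sum>k\<in>UNIV. edge_length T k * normal T k $ i) = 0"
proof -
  have ne: "T$1 \<noteq> T$2" "T$1 \<noteq> T$3" "T$2 \<noteq> T$3"
    using assms by (auto simp: verts_eq insert_commute)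
  define s :: real where
    "s = (if vector [(T$3 - T$2)$2, - ((T$3 - T$2)$1)] \<bullet> (T$1 - T$2) < 0 then 1 else -1)"
  have "edge_length T k * normal T k $ i
      = s * (vector [(T$(k+2) - T$(k+1))$2, - ((T$(k+2) - T$(k+1))$1)] :: real^2) $ i" for k
  proof -
    have "T$(k+1) \<noteq> T$(k+2)" using ne exhaust_3[of k] by (auto simp: three_arith)
    thus ?thesis
      unfolding normal_def Let_def rotated_edge_inner s_def[symmetric] edge_length_def
      by (simp add: dist_norm norm_minus_commute)
  qed
  thus ?thesis using exhaust_2[of i] by (auto simp: sum_3 three_arith algebra_simps)
qed

section \<open>Momentum balance of the steady state\<close>

lemma has_partial_unique:
  assumes "has_partial f i D p" and "has_partial f i D' p"
  shows "D = D'"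
  using assms unfolding has_partial_def by (rule vector_derivative_unique_at)

lemma has_partial_const: "has_partial (\<lambda>_. c) i 0 p"
  by (simp add: has_partial_def)

text \<open>The fluxes depend on \<open>w - B\<close> and the discharges only, which are constant,
  so bed slope and friction must cancel.\<close>

lemma steady_state_balance:
  fixes b q :: "real^2"
  assumes "p \<in> \<Omega>" and "has_partial B 1 (b $ 1) p" and "has_partial B 2 (b $ 2) p"
    and "swe_steady_state g nf \<Omega> B (\<lambda>p. vector [h + B p, q $ 1, q $ 2])"
  shows "g * h * b $ i = - (g * nf\<^sup>2 / h powr (7/3)) * norm q * q $ i"
proof -
  obtain Fx Gy Bx By where *:
    "has_partial (\<lambda>x. flux_x g (vector [h + B x, q $ 1, q $ 2]) (B x)) 1 Fx p"
    "has_partial (\<lambda>x. flux_y g (vector [h + B x, q $ 1, q $ 2]) (B x)) 2 Gy p"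
    "has_partial B 1 Bx p" "has_partial B 2 By p"
    "Fx + Gy = bed_source g (vector [h + B p, q $ 1, q $ 2]) (B p) Bx By
             + friction_source g nf (vector [h + B p, q $ 1, q $ 2]) (B p)"
    using assms(1,4) unfolding swe_steady_state_def by blast
  have "Fx = 0" using *(1) has_partial_unique[OF _ has_partial_const] by (simp add: flux_x_def)
  moreover have "Gy = 0" using *(2) has_partial_unique[OF _ has_partial_const] by (simp add: flux_y_def)
  moreover have "Bx = b $ 1" "By = b $ 2" using assms(2,3) *(3,4) has_partial_unique by blast+
  ultimately have "0 = bed_source g (vector [h + B p, q $ 1, q $ 2]) (B p) (b $ 1) (b $ 2)
      + friction_source g nf (vector [h + B p, q $ 1, q $ 2]) (B p)"
    using *(5) by simp
  moreover have "norm q = sqrt ((q$1)\<^sup>2 + (q$2)\<^sup>2)" by (simp add: norm_vec_def L2_set_def sum_2)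
  ultimately have "g * h * b $ 1 = - (g * nf\<^sup>2 / h powr (7/3)) * norm q * q $ 1"
      and "g * h * b $ 2 = - (g * nf\<^sup>2 / h powr (7/3)) * norm q * q $ 2"
    by (simp_all add: vec_eq_iff forall_3 bed_source_def friction_source_def)
  thus ?thesis using exhaust_2[of i] by auto
qed

section \<open>One time step on a single cell\<close>

lemma euler_step_uniform_flow:
  assumes g: "0 < g" and dt: "0 < dt" and h: "0 < h" and nc: "\<not> collinear (verts T)"
    and state: "has_cell_values B h q T (U T)"
    and Ui: "\<And>k. U_in M B U T k = vector [h + B_mid B T k, q $ 1, q $ 2]"
    and Uo: "\<And>k. U_out M B U T k = vector [h + B_mid B T k, q $ 1, q $ 2]"
    and wg: "w_grad M B U T = b"
    and bal: "\<And>i. g * h * b $ i = - (g * nf\<^sup>2 / h powr (7/3)) * norm q * q $ i"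
  shows "euler_step g nf dt M B U T V \<longleftrightarrow> V = U T"
proof -
  let ?bi = "b_in g M B U T" and ?bo = "b_out g M B U T"
  define C :: state where "C = vector [h, q $ 1, q $ 2]"
  \<comment> \<open>With common normal velocity \<open>l\<close> on both sides, the two speeds are
    at least \<open>s - l\<close> and \<open>s + l\<close>, so their sum is at least
    \<open>2 * s\<close>.\<close>
  have pos: "?bi k + ?bo k \<noteq> 0" for k
  proof -
    define s where "s = sqrt (g * h)"
    have "s > 0" using g h by (simp add: s_def)
    thus ?thesis by (simp add: b_in_def b_out_def Let_def Ui Uo max_def min_def flip: s_def)
  qed
  \<comment> \<open>Rewritten as the flux of \<open>C\<close> over a flat bed, the edge flux no
    longer depends on \<open>k\<close> and leaves the sum.\<close>
  have flux: "flux_x g (vector [h + B_mid B T k, q $ 1, q $ 2]) (B_mid B T k) = flux_x g C 0"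
       "flux_y g (vector [h + B_mid B T k, q $ 1, q $ 2]) (B_mid B T k) = flux_y g C 0" for k
    by (simp_all add: flux_x_def flux_y_def C_def)
  have avg: "(x / (?bi k + ?bo k)) *\<^sub>R (?bi k *\<^sub>R F + ?bo k *\<^sub>R F) = x *\<^sub>R F" for x k and F :: state
    using pos[of k] by (simp add: scaleR_add_left[symmetric])
  have src: "source g M B U T = vector [0, - (g * b $ 1 * h), - (g * b $ 2 * h)]"
  proof -
    have "(\<Sum>k\<in>UNIV. edge_length T k * h\<^sup>2 * normal T k $ i) = h\<^sup>2 * (\<Sum>k\<in>UNIV. edge_length T k * normal T k $ i)" for i
      by (simp add: sum_distrib_left mult_ac)
    moreover have "B_avg B T - U T $ 1 = - h" using state by (simp add: has_cell_values_def)
    ultimately show ?thesis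
      by (simp add: source_def source_comp_def Ui wg sum_edge_length_normal[OF nc])
  qed
  \<comment> \<open>Half of the friction coefficient, since the old and the new discharge each enter
    once; hence the factor 2 in \<open>bal'\<close>.\<close>
  define \<kappa> where "\<kappa> = g * nf\<^sup>2 / 2 * (norm q / h powr (7/3))"
  have \<kappa>: "\<kappa> \<ge> 0" using g by (simp add: \<kappa>_def)
  have bal': "g * b $ i * h = - 2 * \<kappa> * q $ i" for i
    using bal[of i] by (simp add: \<kappa>_def mult_ac)
  have UT: "U T $ 1 - B_avg B T = h" "U T $ 2 = q $ 1" "U T $ 3 = q $ 2"
    using state by (auto simp: has_cell_values_def)
  have "norm q = sqrt ((q$1)\<^sup>2 + (q$2)\<^sup>2)" by (simp add: norm_vec_def L2_set_def sum_2)
  hence fr: "friction g nf B U T V = (- \<kappa>) *\<^sub>R vector [0, q$1 + V$2, q$2 + V$3]"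
    unfolding friction_def UT by (simp add: \<kappa>_def)
  \<comment> \<open>Both flux sums vanish by the closure of the normals, and the jump term because
    the two edge states coincide.\<close>
  have "euler_step g nf dt M B U T V \<longleftrightarrow>
      V = U T + dt *\<^sub>R source g M B U T + dt *\<^sub>R friction g nf B U T V"
    unfolding euler_step_def Let_def Ui Uo flux avg
    by (simp add: scaleR_sum_left[symmetric] sum_edge_length_normal[OF nc])
  also have "\<dots> \<longleftrightarrow> V$1 = U T $ 1 \<and>
      V$2 = q$1 + dt * (2 * \<kappa> * q$1) - dt * \<kappa> * (q$1 + V$2) \<and>
      V$3 = q$2 + dt * (2 * \<kappa> * q$2) - dt * \<kappa> * (q$2 + V$3)"
    unfolding src fr bal' vec_eq_iff forall_3 by (simp add: UT)
  also have "\<dots> \<longleftrightarrow> V = U T"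
  proof -
    have "v = x + dt * (2 * \<kappa> * x) - dt * \<kappa> * (x + v) \<longleftrightarrow> v = x" for v x :: real
    proof -
      have "v = x + dt * (2 * \<kappa> * x) - dt * \<kappa> * (x + v) \<longleftrightarrow> (1 + dt * \<kappa>) * (v - x) = 0"
        by (auto simp: algebra_simps)
      \<comment> \<open>Positivity of this factor makes the implicit equation uniquely
        solvable.\<close>
      moreover have "1 + dt * \<kappa> > 0" using \<kappa> dt by (simp add: add_pos_nonneg)
      ultimately show ?thesis by simp
    qed
    thus ?thesis by (auto simp: vec_eq_iff forall_3 UT)
  qed
  finally show ?thesis .
qed

section \<open>The equilibrium depth and its preservation\<close>

theorem theorem3p1:
  fixes g nf dt h0 q0 B0 :: real
    and M :: "cell set"
    and B :: "real^2 \<Rightarrow> real"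
    and q b :: "real^2"
  assumes "0 < g" and "0 < nf" and "0 < dt"
    and "conforming_mesh M" and "planes_determined M"
    and "0 < h0" and "q0 \<noteq> 0" and "0 < B0"
    and "(q = vector [q0, 0] \<and> b = vector [- B0, 0]) \<or>
         (q = vector [0, q0] \<and> b = vector [0, - B0])"
    and "continuous_on (domain M) B"
    and "\<forall>p\<in>interior (domain M). has_partial B 1 (b $ 1) p \<and> has_partial B 2 (b $ 2) p"
    and "swe_steady_state g nf (interior (domain M)) B (\<lambda>p. vector [h0 + B p, q $ 1, q $ 2])"
  shows "h0 = (nf\<^sup>2 * q0\<^sup>2 / B0) powr (3/10) \<and> preserves g nf dt M B h0 q"
proof
  note g = assms(1) and nf = assms(2) and dt = assms(3) and mesh = assms(4) and h0 = assms(6)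
  have nc: "\<not> collinear (verts T)" if "T \<in> M" for T
    using mesh that by (auto simp: conforming_mesh_def)
  \<comment> \<open>A nondegenerate cell supplies one interior point, enough to extract the balance
    between constants.\<close>
  obtain T0 where T0: "T0 \<in> M" using mesh by (auto simp: conforming_mesh_def)
  have "interior (region T0) \<subseteq> interior (domain M)"
    using T0 by (intro interior_mono) (auto simp: domain_def)
  then obtain p0 where p0: "p0 \<in> interior (domain M)"
    using region_eq_closure_interior(1)[OF nc[OF T0]] by blast
  have bal: "g * h0 * b $ i = - (g * nf\<^sup>2 / h0 powr (7/3)) * norm q * q $ i" for i
    using steady_state_balance[OF p0 _ _ assms(12)] assms(11) p0 by blast
  show "h0 = (nf\<^sup>2 * q0\<^sup>2 / B0) powr (3/10)"
  proof -
    have "norm q = \<bar>q0\<bar>"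
      using assms(9) by (auto simp: norm_vec_def L2_set_def sum_2)
    hence "g * (h0 * B0) = g * (nf\<^sup>2 / h0 powr (7/3) * \<bar>q0\<bar> * q0)"
      using assms(9) bal[of 1] bal[of 2] by auto
    hence eq: "h0 * B0 = nf\<^sup>2 / h0 powr (7/3) * \<bar>q0\<bar> * q0"
      by (rule mult_left_cancel[THEN iffD1, rotated]) (use g in simp)
    \<comment> \<open>A priori the balance contains \<open>\<bar>q0\<bar> * q0\<close>;
      \<open>B0 > 0\<close> forces the flow downhill, which turns this into
      \<open>q0\<^sup>2\<close>.\<close>
    have "nf\<^sup>2 / h0 powr (7/3) * \<bar>q0\<bar> > 0" using nf h0 \<open>q0 \<noteq> 0\<close> by simp
    hence "q0 > 0" using eq h0 \<open>0 < B0\<close> by (metis mult_pos_pos zero_less_mult_pos)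
    hence "h0 * h0 powr (7/3) = nf\<^sup>2 * q0\<^sup>2 / B0"
      using eq h0 \<open>0 < B0\<close> by (simp add: field_simps power2_eq_square)
    moreover have "h0 * h0 powr (7/3) = h0 powr (10/3)"
      using h0 powr_add[of h0 1 "7/3"] by simp
    ultimately show ?thesis using h0 by (simp add: powr_powr flip: \<open>_ = nf\<^sup>2 * q0\<^sup>2 / B0\<close>)
  qed
  obtain c where c: "\<And>T k. T \<in> M \<Longrightarrow> B (T $ k) = b \<bullet> T $ k + c T"
    using affine_on_cell[OF mesh assms(10,11)] by metis
  \<comment> \<open>As the slope \<open>b\<close> is the same everywhere, evaluating
    \<open>B\<close> at one common vertex identifies the constants.\<close>
  have c_nbr: "c T' = c T" if "T \<in> M" "is_nbr M T k T'" for T k T'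
  proof -
    have "T' \<in> M" "T $ (k + 1) \<in> verts T'" using that by (auto simp: is_nbr_def)
    then obtain l where "T $ (k + 1) = T' $ l" by (auto simp: verts_def)
    thus ?thesis using c[OF that(1), of "k + 1"] c[OF \<open>T' \<in> M\<close>, of l] by simp
  qed
  show "preserves g nf dt M B h0 q"
    unfolding preserves_def
  proof (intro allI impI ballI)
    fix U T
    assume U: "\<forall>T\<in>M. has_cell_values B h0 q T (U T)" and "T \<in> evolved_cells M"
    \<comment> \<open>Peeling one layer off \<open>Suc 2\<close> places the neighbors in
      \<open>inner_cells M 2\<close>, where the reconstructions entering \<open>U_out\<close> are
      known.\<close>
    hence T3: "T \<in> inner_cells M (Suc 2)" by (simp add: evolved_cells_def numeral_3_eq_3)
    hence T2: "T \<in> inner_cells M 2" using inner_cells_Suc_subset by blast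
    have T: "T \<in> M" using T2 by (simp add: numeral_2_eq_2)
    have nbr2: "nbr M T k \<in> inner_cells M 2" for k
      using T3 by (simp only: inner_cells.simps) blast
    have nbr: "is_nbr M T k (nbr M T k)" for k using T3 nbr_is_nbr by blast
    have avg1: "U S $ 1 = b \<bullet> center S + (h0 + c S)" if "S \<in> M" for S
    proof -
      have "B_avg B S = b \<bullet> center S + c S"
        by (simp add: B_avg_def center_def c[OF that] sum_3 inner_add_right add_divide_distrib)
      moreover have "U S $ 1 - B_avg B S = h0" using U that by (simp add: has_cell_values_def)
      ultimately show ?thesis by simp
    qed
    \<comment> \<open>The zero slope is written out to match the affine form of the reconstruction
      lemmas.\<close>
    have avg2: "U S $ 2 = 0 \<bullet> center S + q $ 1" "U S $ 3 = 0 \<bullet> center S + q $ 2" if "S \<in> M" for S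
      using U that by (auto simp: has_cell_values_def)
    note planes = assms(5)
    have rec1: "lin_rec M U 1 S p = b \<bullet> p + (h0 + c S)" if "S \<in> inner_cells M 2" for S p
      using lin_rec_affine[OF planes avg1 _ that] c_nbr by auto
    have rec2: "lin_rec M U 2 S p = q $ 1" "lin_rec M U 3 S p = q $ 2"
      if "S \<in> inner_cells M 2" for S p
      using lin_rec_affine[OF planes avg2(1) _ that] lin_rec_affine[OF planes avg2(2) _ that]
      by auto
    have dry: "dry M B U S = {}" if "S \<in> inner_cells M 2" for S
    proof -
      have "S \<in> M" using that by (simp add: numeral_2_eq_2)
      thus ?thesis using h0 by (simp add: dry_def rec1[OF that] c)
    qed
    have rec: "reconstruction M B U S p = vector [h0 + (b \<bullet> p + c S), q $ 1, q $ 2]"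
      if "S \<in> inner_cells M 2" for S p
      using that by (simp add: reconstruction_def w_rec_def dry rec1 rec2 add_ac)
    have mid: "b \<bullet> edge_mid T k + c T = B_mid B T k" for k
      by (simp add: edge_mid_def B_mid_def midpoint_def c[OF T] inner_add_right field_simps)
    have "euler_step g nf dt M B U T V \<longleftrightarrow> V = U T" for V
    proof (rule euler_step_uniform_flow[OF g dt h0 nc[OF T], of B q U M b])
      show "w_grad M B U T = b"
        using grad_affine[OF planes avg1 _ T2] c_nbr by (simp add: w_grad_def dry[OF T2])
      show "U_in M B U T k = vector [h0 + B_mid B T k, q $ 1, q $ 2]" for k
        by (simp add: U_in_def rec[OF T2] mid)
      show "U_out M B U T k = vector [h0 + B_mid B T k, q $ 1, q $ 2]" for k
        \<comment> \<open>The neighbor's plane has the constant of \<open>T\<close>, so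
          \<open>mid\<close> for \<open>T\<close> also evaluates the outer state.\<close>
        by (simp add: U_out_def rec[OF nbr2] mid c_nbr[OF T nbr])
    qed (use U T bal in auto)
    thus "(\<exists>V. euler_step g nf dt M B U T V) \<and>
        (\<forall>V. euler_step g nf dt M B U T V \<longrightarrow> has_cell_values B h0 q T V)"
      using U T by simp
  qed
qed

end
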